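(* Let $(W,S)$ be a Coxeter system with $S$ finite, let $\mathscr{P}$ be a partition of $W$, and let $\widehat{\mathscr{P}}$ be the regular completion of $\mathscr{P}$. (1) We have $\mathscr{P}\leq\widehat{\mathscr{P}}$. (2) If the simple refinements algorithm applied to $\mathscr{P}$ terminates in finite time with output $\mathscr{Q}$, then $\mathscr{Q}=\widehat{\mathscr{P}}$. (3) If $|\mathscr{P}|<\infty$ then the simple refinements algorithm applied to $\mathscr{P}$ terminates in finite time if and only if $|\widehat{\mathscr{P}}|<\infty$.
   Context: $\ell$ is the length function and $D_L(w)=\{s\in S\mid\ell(sw)=\ell(w)-1\}$. A partition of $W$ is a set of nonempty pairwise disjoint subsets (parts) with union $W$; $|\mathscr{P}|$ is the number of parts; $\mathscr{P}\leq\mathscr{P}'$ means each part of $\mathscr{P}'$ is contained in a part of $\mathscr{P}$. A partition is locally constant if $D_L$ is constant on each part $P$ (common value $D_L(P)$). It is regular if it is locally constant and, for each part $P$ and $s\in S\setminus D_L(P)$, $sP\subseteq P'$ for some part $P'$. The set $\mathscr{P}_{\mathrm{reg}}(W)$ of regular partitions, ordered by $\leq$, is a complete lattice, and the regular completion of $\mathscr{P}$ is $\widehat{\mathscr{P}}=\bigwedge\{\mathscr{R}\in\mathscr{P}_{\mathrm{reg}}(W)\mid\mathscr{P}\leq\mathscr{R}\}$ (meet in $\mathscr{P}_{\mathrm{reg}}(W)$). Simple refinement: let $\mathscr{P}$ be locally constant, and let $(P,s)\in\mathscr{P}\times S$ with $s\notin D_L(P)$ and $sP$ not contained in any part of $\mathscr{P}$.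 Let $X=\{P'\in\mathscr{P}\mid P'\cap sP\neq\emptyset\}$. The simple refinement of $\mathscr{P}$ based at $(P,s)$ is obtained by replacing the part $P$ by the parts $P\cap sP'$, $P'\in X$. Simple refinements algorithm with input $\mathscr{P}$: let $\mathscr{P}_0$ be the coarsest common refinement of $\mathscr{P}$ and the partition of $W$ according to left descent sets. For $j\ge1$, if there exists a pair $(P,s)$ with $P\in\mathscr{P}_{j-1}$, $s\in S\setminus D_L(P)$ and $sP$ not contained in any part of $\mathscr{P}_{j-1}$, choose one (arbitrarily) and let $\mathscr{P}_j$ be the simple refinement of $\mathscr{P}_{j-1}$ based at it; otherwise stop and output $\mathscr{P}_{j-1}$. The algorithm terminates in finite time if it stops after finitely many steps; statements about the algorithm are for an arbitrary run, i.e. whatever choices of pairs are made. *)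

theory Defs
  imports
    "HOL-Algebra.Coset"
    "HOL-Algebra.Generated_Groups"
    "HOL-Algebra.Lattice"
    "HOL-Library.Disjoint_Sets"
    "HOL-Library.Extended_Nat"
begin

section \<open>Coxeter systems\<close>

text \<open>
  Words of the free group on a set \<open>S\<close> of generators: the letter \<open>(s, True)\<close> stands for
  \<open>s\<close> and \<open>(s, False)\<close> for its formal inverse.
\<close>

type_synonym 'a gword = "('a \<times> bool) list"

definition word_value :: "('a, 'b) monoid_scheme \<Rightarrow> 'a gword \<Rightarrow> 'a" where
  "word_value G w =
     foldr (\<lambda>(s, b) x. (if b then s else inv\<^bsub>G\<^esub> s) \<otimes>\<^bsub>G\<^esub> x) w \<one>\<^bsub>G\<^esub>"

inductive pres_step :: "'a set \<Rightarrow> 'a gword set \<Rightarrow> 'a gword \<Rightarrow> 'a gword \<Rightarrow> bool"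
  for S :: "'a set" and R :: "'a gword set" where
  cancel: "s \<in> S \<Longrightarrow> pres_step S R (u @ [(s, b), (s, \<not> b)] @ v) (u @ v)"
| relator: "r \<in> R \<Longrightarrow> pres_step S R (u @ r @ v) (u @ v)"

text \<open>
  \<open>G\<close> has the presentation \<open>\<langle>S | R\<rangle>\<close>: the canonical homomorphism from the free group
  on \<open>S\<close> to \<open>G\<close> is onto, and its kernel is the normal closure of \<open>R\<close>, that is, the set of
  words that become trivial by inserting and deleting relators and pairs of mutually inverse
  letters.
\<close>

definition presented_by :: "('a, 'b) monoid_scheme \<Rightarrow> 'a set \<Rightarrow> 'a gword set \<Rightarrow> bool" where
  "presented_by G S R \<longleftrightarrow>
     S \<subseteq> carrier G \<and> generate G S = carrier G \<and>
     (\<forall>w \<in> lists (S \<times> UNIV). word_value G w = \<one>\<^bsub>G\<^esub> \<longleftrightarrow> equivclp (pres_step S R) w [])"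

definition coxeter_matrix :: "'a set \<Rightarrow> ('a \<Rightarrow> 'a \<Rightarrow> enat) \<Rightarrow> bool" where
  "coxeter_matrix S m \<longleftrightarrow>
     (\<forall>s\<in>S. m s s = 1) \<and>
     (\<forall>s\<in>S. \<forall>t\<in>S. s \<noteq> t \<longrightarrow> m s t = m t s \<and> 2 \<le> m s t)"

definition coxeter_relators :: "'a set \<Rightarrow> ('a \<Rightarrow> 'a \<Rightarrow> enat) \<Rightarrow> 'a gword set" where
  "coxeter_relators S m =
     {concat (replicate k [(s, True), (t, True)]) | s t k. s \<in> S \<and> t \<in> S \<and> m s t = enat k}"

definition coxeter_system :: "('a, 'b) monoid_scheme \<Rightarrow> 'a set \<Rightarrow> bool" where
  "coxeter_system W S \<longleftrightarrow>
     group W \<and> (\<exists>m. coxeter_matrix S m \<and> presented_by W S (coxeter_relators S m))"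

text \<open>Positive words suffice here, since the elements of \<open>S\<close> are involutions.\<close>

definition cox_length :: "('a, 'b) monoid_scheme \<Rightarrow> 'a set \<Rightarrow> 'a \<Rightarrow> nat" where
  "cox_length W S w =
     (LEAST n. \<exists>ss \<in> lists S. length ss = n \<and> foldr (\<otimes>\<^bsub>W\<^esub>) ss \<one>\<^bsub>W\<^esub> = w)"

definition left_descents :: "('a, 'b) monoid_scheme \<Rightarrow> 'a set \<Rightarrow> 'a \<Rightarrow> 'a set" where
  "left_descents W S w =
     {s \<in> S. int (cox_length W S (s \<otimes>\<^bsub>W\<^esub> w)) = int (cox_length W S w) - 1}"

section \<open>Regular partitions\<close>

text \<open>Finer partitions are larger.\<close>

definition part_le ::
    "('a, 'b) monoid_scheme \<Rightarrow> 'a set set \<Rightarrow> 'a set set \<Rightarrow> bool" where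
  "part_le W \<P> \<P>' \<longleftrightarrow> refines (carrier W) \<P>' \<P>"

definition locally_constant ::
    "('a, 'b) monoid_scheme \<Rightarrow> 'a set \<Rightarrow> 'a set set \<Rightarrow> bool" where
  "locally_constant W S \<P> \<longleftrightarrow>
     partition_on (carrier W) \<P> \<and>
     (\<forall>P\<in>\<P>. \<forall>v\<in>P. \<forall>w\<in>P. left_descents W S v = left_descents W S w)"

text \<open>Only meaningful for a part of a locally constant partition.\<close>

definition part_descents :: "('a, 'b) monoid_scheme \<Rightarrow> 'a set \<Rightarrow> 'a set \<Rightarrow> 'a set" where
  "part_descents W S P = the_elem (left_descents W S ` P)"

definition regular_partition ::
    "('a, 'b) monoid_scheme \<Rightarrow> 'a set \<Rightarrow> 'a set set \<Rightarrow> bool" where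
  "regular_partition W S \<P> \<longleftrightarrow>
     locally_constant W S \<P> \<and>
     (\<forall>P\<in>\<P>. \<forall>s \<in> S - part_descents W S P. \<exists>P'\<in>\<P>. s <#\<^bsub>W\<^esub> P \<subseteq> P')"

definition reg_order :: "('a, 'b) monoid_scheme \<Rightarrow> 'a set \<Rightarrow> 'a set set gorder" where
  "reg_order W S =
     \<lparr>carrier = {\<R>. regular_partition W S \<R>}, eq = (=), le = part_le W\<rparr>"

definition regular_completion ::
    "('a, 'b) monoid_scheme \<Rightarrow> 'a set \<Rightarrow> 'a set set \<Rightarrow> 'a set set" where
  "regular_completion W S \<P> =
     \<Sqinter>\<^bsub>reg_order W S\<^esub> {\<R> \<in> carrier (reg_order W S). part_le W \<P> \<R>}"

section \<open>The simple refinements algorithm\<close>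

definition refinable_at ::
    "('a, 'b) monoid_scheme \<Rightarrow> 'a set \<Rightarrow> 'a set set \<Rightarrow> 'a set \<Rightarrow> 'a \<Rightarrow> bool" where
  "refinable_at W S \<P> P s \<longleftrightarrow>
     P \<in> \<P> \<and> s \<in> S - part_descents W S P \<and> \<not> (\<exists>P'\<in>\<P>. s <#\<^bsub>W\<^esub> P \<subseteq> P')"

definition simple_refinement ::
    "('a, 'b) monoid_scheme \<Rightarrow> 'a set set \<Rightarrow> 'a set \<Rightarrow> 'a \<Rightarrow> 'a set set" where
  "simple_refinement W \<P> P s =
     (let X = {P' \<in> \<P>. P' \<inter> (s <#\<^bsub>W\<^esub> P) \<noteq> {}}
      in (\<P> - {P}) \<union> (\<lambda>P'. P \<inter> (s <#\<^bsub>W\<^esub> P')) ` X)"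

definition descent_partition :: "('a, 'b) monoid_scheme \<Rightarrow> 'a set \<Rightarrow> 'a set set" where
  "descent_partition W S =
     (\<lambda>v. {w \<in> carrier W. left_descents W S w = left_descents W S v}) ` carrier W"

definition initial_partition ::
    "('a, 'b) monoid_scheme \<Rightarrow> 'a set \<Rightarrow> 'a set set \<Rightarrow> 'a set set" where
  "initial_partition W S \<P> = common_refinement {\<P>, descent_partition W S}"

text \<open>
  A run is the sequence \<open>\<P>\<^sub>0, \<P>\<^sub>1, \<dots>\<close> produced by an arbitrary sequence of choices of pairs;
  \<open>run j = None\<close> means that the algorithm has stopped before \<open>\<P>\<^sub>j\<close> was constructed.
\<close>

definition algorithm_run ::
    "('a, 'b) monoid_scheme \<Rightarrow> 'a set \<Rightarrow> 'a set set \<Rightarrow> (nat \<Rightarrow> 'a set set option) \<Rightarrow> bool" where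
  "algorithm_run W S \<P> run \<longleftrightarrow>
     run 0 = Some (initial_partition W S \<P>) \<and>
     (\<forall>j. case run j of
            None \<Rightarrow> run (Suc j) = None
          | Some \<Q> \<Rightarrow>
              if \<exists>P s. refinable_at W S \<Q> P s
              then \<exists>P s. refinable_at W S \<Q> P s \<and>
                         run (Suc j) = Some (simple_refinement W \<Q> P s)
              else run (Suc j) = None)"

definition outputs :: "(nat \<Rightarrow> 'a set set option) \<Rightarrow> 'a set set \<Rightarrow> bool" where
  "outputs run \<Q> \<longleftrightarrow> (\<exists>j. run j = Some \<Q> \<and> run (Suc j) = None)"

definition terminates :: "(nat \<Rightarrow> 'a set set option) \<Rightarrow> bool" where
  "terminates run \<longleftrightarrow> (\<exists>\<Q>. outputs run \<Q>)"

end

(*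
  In terms of the relation "lies in the same part", a partition is regular iff related elements
  have the same left descents and stay related under left multiplication by a non-descent.  This
  condition is inherited by the transitive closure of a union of such relations, so there is a
  coarsest regular partition finer than \<P>.  A simple refinement only makes splits forced upon
  every regular partition finer than \<P>, so all partitions met by the algorithm are coarser than
  the completion; the algorithm can only stop at a regular partition, which is then the completion
  itself.  As each step increases the number of parts, finiteness of the completion forces the
  algorithm to stop.
*)
theory Submission
  imports Defs
begin

section \<open>Refinements of partitions\<close>

lemma partition_on_part_ex:
  assumes "partition_on A P" "X \<in> P"
  obtains x where "x \<in> X" "x \<in> A" "X \<subseteq> A"
proof -
  have "X \<subseteq> A" using assms partition_onD1[of A P] by blast
  moreover have "X \<noteq> {}" using assms partition_onD3[of A P] by blast
  ultimately show thesis using that by blast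
qed

lemma partition_on_part_unique:
  assumes "partition_on A P" "X \<in> P" "Y \<in> P" "x \<in> X" "x \<in> Y"
  shows "X = Y"
  using disjointD[OF partition_onD2[OF assms(1)] assms(2,3)] assms(4,5) by blast

text \<open>Choosing for each part of \<open>R\<close> a part of \<open>Q\<close> around it is
  automatically onto: a point of a part \<open>q\<close> lies in some part \<open>r\<close> of
  \<open>R\<close>, and \<open>f r\<close> shares that point with \<open>q\<close>, so disjointness
  forces \<open>f r = q\<close>.\<close>

lemma refines_ex_surj:
  assumes "refines A R Q"
  obtains f where "f ` R = Q" "\<And>r. r \<in> R \<Longrightarrow> r \<subseteq> f r"
proof -
  have R: "partition_on A R" and Q: "partition_on A Q" and "\<forall>r\<in>R. \<exists>q\<in>Q. r \<subseteq> q"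
    using assms unfolding refines_def by blast+
  then obtain f where f: "\<And>r. r \<in> R \<Longrightarrow> f r \<in> Q" "\<And>r. r \<in> R \<Longrightarrow> r \<subseteq> f r"
    by metis
  have "q \<in> f ` R" if "q \<in> Q" for q
  proof -
    obtain x where "x \<in> q" using partition_on_part_ex[OF Q \<open>q \<in> Q\<close>] by blast
    moreover then obtain r where "r \<in> R" "x \<in> r"
      using R Q \<open>q \<in> Q\<close> unfolding partition_on_def by blast
    ultimately have "f r = q"
      using f \<open>q \<in> Q\<close> \<open>x \<in> q\<close> by (intro partition_on_part_unique[OF Q]) auto
    then show ?thesis using \<open>r \<in> R\<close> by blast
  qed
  then have "f ` R = Q" using f(1) by blast
  then show thesis using f(2) by (rule that)
qed

lemma refines_card_le:
  assumes "refines A R Q" "finite R"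
  shows "finite Q" "card Q \<le> card R"
proof -
  obtain f where "f ` R = Q" using refines_ex_surj[OF assms(1)] by blast
  then show "finite Q" "card Q \<le> card R" using assms(2) card_image_le by auto
qed

text \<open>If the number of parts did not grow, the surjection from \<open>R\<close> onto
  \<open>Q\<close> would be injective, so every part of \<open>Q\<close> would contain only one part
  of \<open>R\<close> and hence coincide with it.\<close>

lemma refines_card_less:
  assumes "refines A R Q" "finite R" "R \<noteq> Q"
  shows "card Q < card R"
proof (rule ccontr)
  assume "\<not> card Q < card R"
  obtain f where f: "f ` R = Q" "\<And>r. r \<in> R \<Longrightarrow> r \<subseteq> f r"
    using refines_ex_surj[OF assms(1)] by blast
  have "inj_on f R"
    using \<open>\<not> card Q < card R\<close> f(1) assms(2) by (metis card_image_le eq_card_imp_inj_on le_neq_implies_less)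
  have R: "partition_on A R" and Q: "partition_on A Q"
    using assms(1) unfolding refines_def by blast+
  \<comment> \<open>A point of \<open>f r\<close> lies in some part \<open>r'\<close> with the same
    image under \<open>f\<close>, and injectivity gives \<open>r' = r\<close>.\<close>
  have "f r = r" if "r \<in> R" for r
  proof
    show "f r \<subseteq> r"
    proof
      fix x assume "x \<in> f r"
      have "f r \<in> Q" using f(1) \<open>r \<in> R\<close> by blast
      then obtain r' where r': "r' \<in> R" "x \<in> r'"
        using \<open>x \<in> f r\<close> partition_onD1[OF R] partition_onD1[OF Q] by blast
      then have "f r' = f r"
        using f \<open>f r \<in> Q\<close> \<open>x \<in> f r\<close> by (intro partition_on_part_unique[OF Q]) auto
      then have "r' = r" by (rule inj_onD[OF \<open>inj_on f R\<close> _ r'(1) \<open>r \<in> R\<close>])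
      then show "x \<in> r" using r'(2) by simp
    qed
  qed (use f(2) that in blast)
  then have "R = Q" using f(1) by auto
  then show False using assms(3) by blast
qed

section \<open>Regular partitions\<close>

text \<open>The braid relations play no role: all that matters is that the generators are involutions.\<close>

locale involutions = group W for W :: "('a, 'b) monoid_scheme" (structure) +
  fixes S :: "'a set"
  assumes gens_closed: "S \<subseteq> carrier W"
    and gens_square: "s \<in> S \<Longrightarrow> s \<otimes> s = \<one>"

text \<open>The diagonal entry \<open>m s s = 1\<close> makes the two-letter word \<open>ss\<close>
  itself a relator, so its value in the group is trivial.\<close>

lemma coxeter_system_involutions:
  assumes "coxeter_system W S"
  shows "involutions W S"
proof -
  interpret group W using assms unfolding coxeter_system_def by blast
  obtain m where m: "coxeter_matrix S m" and pres: "presented_by W S (coxeter_relators S m)"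
    using assms unfolding coxeter_system_def by blast
  show ?thesis
  proof
    show "S \<subseteq> carrier W" using pres unfolding presented_by_def by blast
    fix s assume "s \<in> S"
    let ?w = "[(s, True), (s, True)]"
    have "m s s = enat 1" using m \<open>s \<in> S\<close> unfolding coxeter_matrix_def by (simp add: one_enat_def)
    moreover have "?w = concat (replicate 1 ?w)" by simp
    ultimately have "?w \<in> coxeter_relators S m"
      unfolding coxeter_relators_def using \<open>s \<in> S\<close> by blast
    then have "pres_step S (coxeter_relators S m) ([] @ ?w @ []) ([] @ [])"
      by (rule pres_step.relator)
    then have "equivclp (pres_step S (coxeter_relators S m)) ?w []"
      by (simp add: r_into_equivclp)
    moreover have "?w \<in> lists (S \<times> UNIV)" using \<open>s \<in> S\<close> by simp
    ultimately have "word_value W ?w = \<one>\<^bsub>W\<^esub>"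
      using pres unfolding presented_by_def by blast
    then show "s \<otimes>\<^bsub>W\<^esub> s = \<one>\<^bsub>W\<^esub>"
      using \<open>s \<in> S\<close> \<open>S \<subseteq> carrier W\<close> by (auto simp: word_value_def)
  qed
qed

lemma refines_locally_constant:
  assumes "locally_constant W S Q" "refines (carrier W) R Q"
  shows "locally_constant W S R"
  unfolding locally_constant_def
proof (intro conjI ballI)
  show "partition_on (carrier W) R" using assms(2) unfolding refines_def by blast
  fix P v w assume "P \<in> R" "v \<in> P" "w \<in> P"
  moreover from this obtain P' where "P' \<in> Q" "P \<subseteq> P'"
    using assms(2) unfolding refines_def by blast
  ultimately show "left_descents W S v = left_descents W S w"
    using assms(1) unfolding locally_constant_def by blast
qed

text \<open>Local constancy makes the image of \<open>P\<close> under \<open>left_descents\<close> a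
  singleton, so \<open>the_elem\<close> is well defined and any representative computes it.\<close>

lemma part_descents_eq:
  assumes "locally_constant W S Q" "P \<in> Q" "x \<in> P"
  shows "part_descents W S P = left_descents W S x"
proof -
  have "\<And>y. y \<in> P \<Longrightarrow> left_descents W S y = left_descents W S x"
    using assms unfolding locally_constant_def by blast
  then have "left_descents W S ` P = {left_descents W S x}"
    using \<open>x \<in> P\<close> by blast
  then show ?thesis unfolding part_descents_def by simp
qed

context involutions
begin

section \<open>Left multiplication by a generator\<close>

lemma gen_mult_cancel:
  assumes "s \<in> S" "x \<in> carrier W"
  shows "s \<otimes> x \<in> carrier W" "s \<otimes> (s \<otimes> x) = x"
proof -
  have "s \<in> carrier W" using assms gens_closed by blast
  then show "s \<otimes> x \<in> carrier W" using assms by simp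
  show "s \<otimes> (s \<otimes> x) = x"
    using \<open>s \<in> carrier W\<close> assms gens_square m_assoc[of s s x] by simp
qed

text \<open>Multiplication by \<open>s\<close> is its own inverse, so the image of \<open>P\<close>
  under it is also its preimage.\<close>

lemma mem_gen_l_coset_iff:
  assumes "s \<in> S" "P \<subseteq> carrier W"
  shows "x \<in> s <# P \<longleftrightarrow> x \<in> carrier W \<and> s \<otimes> x \<in> P"
proof
  assume "x \<in> s <# P"
  then show "x \<in> carrier W \<and> s \<otimes> x \<in> P"
    using assms gen_mult_cancel unfolding l_coset_def by auto
next
  assume "x \<in> carrier W \<and> s \<otimes> x \<in> P"
  then have "s \<otimes> x \<in> P" "x = s \<otimes> (s \<otimes> x)"
    using gen_mult_cancel(2)[OF assms(1)] by auto
  then show "x \<in> s <# P" unfolding l_coset_def by blast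
qed

lemma gen_l_coset_subset_iff:
  assumes "s \<in> S" "P \<subseteq> carrier W" "Q \<subseteq> carrier W"
  shows "s <# P \<subseteq> Q \<longleftrightarrow> P \<subseteq> s <# Q"
proof -
  have "s <# P \<subseteq> Q \<longleftrightarrow> (\<forall>x\<in>P. s \<otimes> x \<in> Q)"
    unfolding l_coset_def by blast
  also have "\<dots> \<longleftrightarrow> P \<subseteq> s <# Q"
    using assms by (auto simp: mem_gen_l_coset_iff)
  finally show ?thesis .
qed

section \<open>Regularity in terms of pairs of elements\<close>

lemma locally_constant_left_descents:
  assumes "locally_constant W S R" "P \<in> R" "x \<in> P" "y \<in> P"
  shows "left_descents W S x = left_descents W S y"
  using part_descents_eq[OF assms(1-3)] part_descents_eq[OF assms(1,2,4)] by simp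

lemma regular_partition_step:
  assumes reg: "regular_partition W S R" and "P \<in> R" "x \<in> P" "y \<in> P"
    and s: "s \<in> S - left_descents W S x"
  shows "\<exists>P'\<in>R. s \<otimes> x \<in> P' \<and> s \<otimes> y \<in> P'"
proof -
  have "s \<in> S - part_descents W S P"
    using reg s part_descents_eq[of W S R P x] \<open>P \<in> R\<close> \<open>x \<in> P\<close>
    unfolding regular_partition_def by simp
  then obtain P' where "P' \<in> R" "s <# P \<subseteq> P'"
    using reg \<open>P \<in> R\<close> unfolding regular_partition_def by blast
  then show ?thesis
    using \<open>x \<in> P\<close> \<open>y \<in> P\<close> unfolding l_coset_def by blast
qed

text \<open>Together with \<open>regular_partition_step\<close>, this replaces containments between
  cosets and parts by conditions on pairs in a common part, a form that survives passing to a
  transitive closure.\<close>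

lemma regular_partitionI:
  assumes R: "partition_on (carrier W) R"
    and desc: "\<And>P x y. P \<in> R \<Longrightarrow> x \<in> P \<Longrightarrow> y \<in> P \<Longrightarrow> left_descents W S x = left_descents W S y"
    and step: "\<And>P x y s. P \<in> R \<Longrightarrow> x \<in> P \<Longrightarrow> y \<in> P \<Longrightarrow> s \<in> S - left_descents W S x \<Longrightarrow>
      \<exists>P'\<in>R. s \<otimes> x \<in> P' \<and> s \<otimes> y \<in> P'"
  shows "regular_partition W S R"
proof -
  have lc: "locally_constant W S R"
    unfolding locally_constant_def using R desc by blast
  moreover have "\<exists>P'\<in>R. s <# P \<subseteq> P'" if "P \<in> R" "s \<in> S - part_descents W S P" for P s
  proof -
    obtain x where "x \<in> P" using partition_on_part_ex[OF R \<open>P \<in> R\<close>] by blast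
    then have s: "s \<in> S - left_descents W S x"
      using that part_descents_eq[OF lc \<open>P \<in> R\<close>] by simp
    \<comment> \<open>The pair \<open>(x, x)\<close> fixes the part \<open>P'\<close> of
      \<open>s \<otimes> x\<close>; as that part is unique, it serves for every other
      \<open>y\<close> in \<open>P\<close> as well.\<close>
    then obtain P' where P': "P' \<in> R" "s \<otimes> x \<in> P'"
      using step[OF \<open>P \<in> R\<close> \<open>x \<in> P\<close> \<open>x \<in> P\<close>] by blast
    have "s \<otimes> y \<in> P'" if "y \<in> P" for y
    proof -
      obtain P'' where "P'' \<in> R" "s \<otimes> x \<in> P''" "s \<otimes> y \<in> P''"
        using step[OF \<open>P \<in> R\<close> \<open>x \<in> P\<close> \<open>y \<in> P\<close> s] by blast
      then show ?thesis
        using P' partition_on_part_unique[OF R, of P' P''] by blast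
    qed
    then show ?thesis using \<open>P' \<in> R\<close> unfolding l_coset_def by blast
  qed
  ultimately show ?thesis unfolding regular_partition_def by blast
qed

text \<open>The finest partition of the group refines every other one, so each partition has at
  least one regular refinement.\<close>

lemma regular_singletons: "regular_partition W S ((\<lambda>x. {x}) ` carrier W)"
proof (rule regular_partitionI)
  fix P x y s
  assume P: "P \<in> (\<lambda>x. {x}) ` carrier W" "x \<in> P" "y \<in> P" and "s \<in> S - left_descents W S x"
  then have "s \<otimes> x \<in> carrier W" "x = y" using gen_mult_cancel(1)[of s x] by auto
  then show "\<exists>P'\<in>(\<lambda>x. {x}) ` carrier W. s \<otimes> x \<in> P' \<and> s \<otimes> y \<in> P'" by blast
qed (auto simp: partition_on_singletons)

section \<open>Existence and identification of the regular completion\<close>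

lemma ex_coarsest_regular:
  assumes P: "partition_on (carrier W) \<P>"
  obtains M where "regular_partition W S M" "part_le W \<P> M"
    "\<And>R. regular_partition W S R \<Longrightarrow> part_le W \<P> R \<Longrightarrow> part_le W M R"
proof -
  define same where "same R = {(x, y). \<exists>p\<in>R. x \<in> p \<and> y \<in> p}" for R :: "'a set set"
  define A where "A = {R. regular_partition W S R \<and> part_le W \<P> R}"
  \<comment> \<open>The closure is only transitive: a reflexive one would add pairs outside the
    carrier. Reflexivity on the carrier comes from the singleton partition, which belongs to
    \<open>A\<close>.\<close>
  define E where "E = (\<Union>R\<in>A. same R)\<^sup>+"
  have part: "partition_on (carrier W) R" if "R \<in> A" for R
    using that unfolding A_def part_le_def refines_def by blast
  have eq: "equiv (carrier W) (same R)" if "partition_on (carrier W) R" for R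
    using equiv_partition_on[OF that] unfolding same_def .
  have singl: "(\<lambda>x. {x}) ` carrier W \<in> A"
    unfolding A_def part_le_def refines_def
    using regular_singletons P partition_on_singletons[of "carrier W"] partition_onD1[OF P]
    by auto
  \<comment> \<open>This is the induction principle for \<open>E\<close>; it yields in turn that
    \<open>E\<close> stays in the carrier, that \<open>E\<close> respects descents and ascending
    steps, and that \<open>E\<close> refines \<open>\<P>\<close>.\<close>
  have gen: "E \<subseteq> F" if "\<And>R. R \<in> A \<Longrightarrow> same R \<subseteq> F" "trans F" for F
  proof -
    have "(\<Union>R\<in>A. same R) \<subseteq> F" using that(1) by blast
    then show ?thesis unfolding E_def using \<open>trans F\<close> by (metis trancl_id trancl_mono subsetI subrelI)
  qed
  have incl: "same R \<subseteq> E" if "R \<in> A" for R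
    unfolding E_def using that trancl.r_into_trancl[of _ _ "\<Union>R\<in>A. same R"] by auto
  have E_equiv: "equiv (carrier W) E"
  proof (rule equivI)
    show "E \<subseteq> carrier W \<times> carrier W"
      by (rule gen) (use eq[OF part] in \<open>auto simp: equiv_def trans_def\<close>)
    show "refl_on (carrier W) E"
      using incl[OF singl] unfolding refl_on_def same_def by blast
    show "sym E"
      unfolding E_def by (rule sym_trancl) (auto simp: sym_def same_def)
    show "trans E" unfolding E_def by simp
  qed
  define M where "M = carrier W // E"
  have partM: "partition_on (carrier W) M"
    unfolding M_def using E_equiv by (rule partition_on_quotient)
  have class_E: "E `` {x} \<in> M" "x \<in> E `` {x}" if "x \<in> carrier W" for x
    using that equiv_class_self[OF E_equiv] unfolding M_def by (auto intro: quotientI)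
  have M_E: "(x, y) \<in> E" if "p \<in> M" "x \<in> p" "y \<in> p" for p x y
    using that quotient_eq_iff[OF E_equiv] unfolding M_def by blast
  show thesis
  proof
    \<comment> \<open>Asking the moved pair to lie in \<open>E\<close>, rather than in one
      \<open>same R\<close>, is what makes the condition transitive: equal descent sets let the same
      \<open>s\<close> act on both links of a chain, and \<open>E\<close> is transitive.\<close>
    have "E \<subseteq> {(x, y). left_descents W S x = left_descents W S y \<and>
        (\<forall>s \<in> S - left_descents W S x. (s \<otimes> x, s \<otimes> y) \<in> E)}" (is "_ \<subseteq> ?F")
    proof (rule gen)
      fix R assume R: "R \<in> A"
      then have reg: "regular_partition W S R" unfolding A_def by blast
      show "same R \<subseteq> ?F"
      proof (intro subrelI CollectI case_prodI conjI ballI)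
        fix x y assume "(x, y) \<in> same R"
        then obtain P where P: "P \<in> R" "x \<in> P" "y \<in> P" unfolding same_def by blast
        then show "left_descents W S x = left_descents W S y"
          using reg locally_constant_left_descents unfolding regular_partition_def by blast
        fix s assume "s \<in> S - left_descents W S x"
        then have "(s \<otimes> x, s \<otimes> y) \<in> same R"
          using regular_partition_step[OF reg P] unfolding same_def by blast
        then show "(s \<otimes> x, s \<otimes> y) \<in> E" using incl[OF R] by blast
      qed
    next
      show "trans ?F"
      proof (rule transI)
        fix x y z assume xy: "(x, y) \<in> ?F" and yz: "(y, z) \<in> ?F"
        have "(s \<otimes> x, s \<otimes> z) \<in> E" if "s \<in> S - left_descents W S x" for s
        proof -
          have "(s \<otimes> x, s \<otimes> y) \<in> E" "(s \<otimes> y, s \<otimes> z) \<in> E" using xy yz that by auto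
          then show ?thesis using E_equiv by (meson equivE transD)
        qed
        then show "(x, z) \<in> ?F" using xy yz by auto
      qed
    qed
    then have F: "left_descents W S x = left_descents W S y"
      "\<And>s. s \<in> S - left_descents W S x \<Longrightarrow> (s \<otimes> x, s \<otimes> y) \<in> E"
      if "(x, y) \<in> E" for x y
      using that by blast+
    have inM: "\<exists>p\<in>M. x \<in> p \<and> y \<in> p" if "(x, y) \<in> E" for x y
    proof -
      have "x \<in> carrier W" using that E_equiv unfolding equiv_def by blast
      then show ?thesis using class_E that by blast
    qed
    show "regular_partition W S M"
    proof (rule regular_partitionI[OF partM])
      fix p x y assume "p \<in> M" "x \<in> p" "y \<in> p"
      then have xy: "(x, y) \<in> E" by (rule M_E)
      then show "left_descents W S x = left_descents W S y" by (rule F)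
      fix s assume "s \<in> S - left_descents W S x"
      with xy have "(s \<otimes> x, s \<otimes> y) \<in> E" by (rule F)
      then show "\<exists>p\<in>M. s \<otimes> x \<in> p \<and> s \<otimes> y \<in> p" by (rule inM)
    qed
    have "E \<subseteq> same \<P>"
    proof (rule gen)
      fix R assume "R \<in> A"
      then have R: "\<forall>X\<in>R. \<exists>Y\<in>\<P>. X \<subseteq> Y" unfolding A_def part_le_def refines_def by blast
      show "same R \<subseteq> same \<P>"
      proof (rule subrelI)
        fix x y assume "(x, y) \<in> same R"
        then obtain X where "X \<in> R" "x \<in> X" "y \<in> X" unfolding same_def by blast
        moreover from this obtain Y where "Y \<in> \<P>" "X \<subseteq> Y" using R by blast
        ultimately show "(x, y) \<in> same \<P>" unfolding same_def by blast
      qed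
    qed (use eq[OF P] in \<open>auto simp: equiv_def\<close>)
    then show "part_le W \<P> M"
      unfolding part_le_def refines_def
    proof (intro conjI ballI)
      fix X assume X: "X \<in> M"
      then obtain x where x: "x \<in> X" "x \<in> carrier W"
        using partition_on_part_ex[OF partM] by blast
      then obtain Y where Y: "Y \<in> \<P>" "x \<in> Y" using P unfolding partition_on_def by blast
      have "y \<in> Y" if "y \<in> X" for y
      proof -
        obtain p where "p \<in> \<P>" "x \<in> p" "y \<in> p"
          using M_E[OF X x(1) \<open>y \<in> X\<close>] \<open>E \<subseteq> same \<P>\<close> unfolding same_def by blast
        then show ?thesis using Y partition_on_part_unique[OF P, of p Y] by blast
      qed
      then show "\<exists>Y\<in>\<P>. X \<subseteq> Y" using Y by blast
    qed (use P partM in auto)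
    fix R assume "regular_partition W S R" "part_le W \<P> R"
    then have R: "R \<in> A" unfolding A_def by blast
    show "part_le W M R"
      unfolding part_le_def refines_def
    proof (intro conjI ballI)
      fix X assume X: "X \<in> R"
      then obtain x where x: "x \<in> X" "x \<in> carrier W"
        using partition_on_part_ex[OF part[OF R]] by blast
      \<comment> \<open>\<open>E\<close> contains \<open>same R\<close>, so its classes are unions
        of parts of \<open>R\<close>; this makes \<open>M\<close> the coarsest candidate.\<close>
      then have "X \<subseteq> E `` {x}" using incl[OF R] X unfolding same_def by blast
      then show "\<exists>Y\<in>M. X \<subseteq> Y" using class_E x by blast
    qed (use part[OF R] partM in auto)
  qed
qed

text \<open>\<open>M\<close> is itself a member of the set whose meet is taken, so it is a greatest
  lower bound. The meet is defined by a choice operator; antisymmetry of refinement leaves only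
  \<open>M\<close> to choose.\<close>

lemma regular_completion_eq:
  assumes M: "regular_partition W S M" "part_le W \<P> M"
    "\<And>R. regular_partition W S R \<Longrightarrow> part_le W \<P> R \<Longrightarrow> part_le W M R"
  shows "regular_completion W S \<P> = M"
proof -
  let ?L = "reg_order W S"
  let ?A = "{R \<in> carrier ?L. part_le W \<P> R}"
  have "M \<in> ?A" using M unfolding reg_order_def by simp
  have "greatest ?L M (Lower ?L ?A)"
    using M \<open>M \<in> ?A\<close> unfolding greatest_def Lower_def by (auto simp: reg_order_def)
  moreover have "N = M" if "greatest ?L N (Lower ?L ?A)" for N
  proof -
    have "part_le W N M" "part_le W M N"
      using that calculation \<open>M \<in> ?A\<close> unfolding greatest_def Lower_def
      by (auto simp: reg_order_def)
    then show ?thesis unfolding part_le_def by (metis refines_asym)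
  qed
  ultimately show ?thesis
    unfolding regular_completion_def inf_def by (rule some_equality)
qed

lemma
  assumes "partition_on (carrier W) \<P>"
  shows part_le_regular_completion: "part_le W \<P> (regular_completion W S \<P>)"
    and regular_regular_completion: "regular_partition W S (regular_completion W S \<P>)"
proof -
  obtain M where M: "regular_partition W S M" "part_le W \<P> M"
    "\<And>R. regular_partition W S R \<Longrightarrow> part_le W \<P> R \<Longrightarrow> part_le W M R"
    using ex_coarsest_regular[OF assms] by blast
  have "regular_completion W S \<P> = M" using M by (rule regular_completion_eq)
  with M show "part_le W \<P> (regular_completion W S \<P>)"
    "regular_partition W S (regular_completion W S \<P>)"
    by simp_all
qed

section \<open>The simple refinements algorithm\<close>

lemma refines_simple_refinement:
  assumes Q: "partition_on (carrier W) Q" and ref: "refinable_at W S Q P s"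
  shows "refines (carrier W) (simple_refinement W Q P s) Q"
proof -
  have P: "P \<in> Q" "s \<in> S" "P \<subseteq> carrier W"
    using Q ref partition_onD1[OF Q] unfolding refinable_at_def by auto
  have sub: "P' \<subseteq> carrier W" if "P' \<in> Q" for P'
    using that partition_onD1[OF Q] by blast
  \<comment> \<open>As \<open>s\<close> is an involution, \<open>P'\<close> meets
    \<open>s <# P\<close> exactly when \<open>P\<close> meets \<open>s <# P'\<close>. The index set
    of the definition thus selects exactly the nonempty pieces of \<open>P\<close>.\<close>
  have mem: "X \<in> simple_refinement W Q P s \<longleftrightarrow> X \<in> Q - {P} \<or>
      (\<exists>P'\<in>Q. X = P \<inter> (s <# P') \<and> X \<noteq> {})" for X
  proof -
    have "P' \<inter> (s <# P) \<noteq> {} \<longleftrightarrow> P \<inter> (s <# P') \<noteq> {}" if "P' \<in> Q" for P'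
      using P sub[OF that] gen_mult_cancel[OF P(2)]
      by (auto simp: mem_gen_l_coset_iff set_eq_iff subset_iff)
    then show ?thesis unfolding simple_refinement_def Let_def by auto
  qed
  have disjQ: "X = Y" if "X \<in> Q" "Y \<in> Q" "x \<in> X" "x \<in> Y" for X Y x
    using partition_on_part_unique[OF Q that] .
  have "partition_on (carrier W) (simple_refinement W Q P s)"
  proof (rule partition_onI)
    show "\<Union> (simple_refinement W Q P s) = carrier W"
    proof
      show "\<Union> (simple_refinement W Q P s) \<subseteq> carrier W"
        using mem sub P by blast
      show "carrier W \<subseteq> \<Union> (simple_refinement W Q P s)"
      proof
        fix x assume x: "x \<in> carrier W"
        show "x \<in> \<Union> (simple_refinement W Q P s)"
        proof (cases "x \<in> P")
          case True
          obtain P' where P': "P' \<in> Q" "s \<otimes> x \<in> P'"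
            using gen_mult_cancel(1)[OF P(2) x] partition_onD1[OF Q] by blast
          then have "x \<in> P \<inter> (s <# P')"
            using True x P sub by (simp add: mem_gen_l_coset_iff)
          moreover from this have "P \<inter> (s <# P') \<in> simple_refinement W Q P s"
            unfolding mem using P' by blast
          ultimately show ?thesis by blast
        next
          case False
          obtain X where "X \<in> Q" "x \<in> X" using x partition_onD1[OF Q] by blast
          moreover from this have "X \<in> simple_refinement W Q P s"
            unfolding mem using False by blast
          ultimately show ?thesis by blast
        qed
      qed
    qed
    show "{} \<notin> simple_refinement W Q P s"
      using mem partition_onD3[OF Q] by blast
    fix X Y assume X: "X \<in> simple_refinement W Q P s" and Y: "Y \<in> simple_refinement W Q P s"
      and "X \<noteq> Y"
    have "X = Y" if "x \<in> X" "x \<in> Y" for x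
    proof (cases "x \<in> P")
      case True
      \<comment> \<open>A point of \<open>P\<close> can only lie in new pieces, and the piece is
        determined by the part containing \<open>s \<otimes> x\<close>.\<close>
      then have "X \<notin> Q - {P}" "Y \<notin> Q - {P}" using that disjQ[OF _ P(1)] by blast+
      then obtain X' Y' where X': "X' \<in> Q" "X = P \<inter> (s <# X')" and Y': "Y' \<in> Q" "Y = P \<inter> (s <# Y')"
        using X Y unfolding mem by blast
      then have "s \<otimes> x \<in> X'" "s \<otimes> x \<in> Y'"
        using that P sub by (auto simp: mem_gen_l_coset_iff)
      then have "X' = Y'" using X' Y' disjQ by blast
      then show ?thesis using X' Y' by simp
    next
      case False
      then have "X \<in> Q" "Y \<in> Q" using X Y that unfolding mem by blast+
      then show ?thesis using disjQ that by blast
    qed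
    then show "disjnt X Y" using \<open>X \<noteq> Y\<close> unfolding disjnt_iff by blast
  qed
  then show ?thesis
    unfolding refines_def using Q mem P by blast
qed

text \<open>If nothing changed, \<open>P\<close> would be one of its own pieces, that is
  \<open>P \<subseteq> s <# P'\<close> for some part \<open>P'\<close>; moving \<open>s\<close>
  across contradicts refinability.\<close>

lemma simple_refinement_neq:
  assumes Q: "partition_on (carrier W) Q" and ref: "refinable_at W S Q P s"
  shows "simple_refinement W Q P s \<noteq> Q"
proof
  assume "simple_refinement W Q P s = Q"
  have P: "P \<in> Q" "s \<in> S" "P \<subseteq> carrier W"
    using Q ref partition_onD1[OF Q] unfolding refinable_at_def by auto
  then have "P \<in> simple_refinement W Q P s" using \<open>simple_refinement W Q P s = Q\<close> by blast
  then obtain P' where P': "P' \<in> Q" "P \<subseteq> s <# P'"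
    unfolding simple_refinement_def Let_def by auto
  moreover have "P' \<subseteq> carrier W" using P' partition_onD1[OF Q] by blast
  ultimately have "s <# P \<subseteq> P'"
    using P by (simp add: gen_l_coset_subset_iff)
  then show False using P' ref unfolding refinable_at_def by blast
qed

text \<open>The split is forced: a part \<open>X\<close> of \<open>R\<close> inside \<open>P\<close>
  has the descents of \<open>P\<close>, so regularity sends \<open>s <# X\<close> into one part of
  \<open>R\<close>, hence into one part \<open>B'\<close> of \<open>Q\<close>, and \<open>X\<close>
  stays within the piece cut out by \<open>B'\<close>.\<close>

lemma simple_refinement_le_regular:
  assumes Q: "locally_constant W S Q" and ref: "refinable_at W S Q P s"
    and R: "regular_partition W S R" and "part_le W Q R"
  shows "part_le W (simple_refinement W Q P s) R"
proof -
  have lcR: "locally_constant W S R" using R unfolding regular_partition_def by blast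
  have pR: "partition_on (carrier W) R" and pQ: "partition_on (carrier W) Q"
    using lcR Q unfolding locally_constant_def by blast+
  have P: "P \<in> Q" "s \<in> S - part_descents W S P"
    using ref unfolding refinable_at_def by auto
  have "\<exists>Y\<in>simple_refinement W Q P s. X \<subseteq> Y" if X: "X \<in> R" for X
  proof -
    obtain B where B: "B \<in> Q" "X \<subseteq> B"
      using X \<open>part_le W Q R\<close> unfolding part_le_def refines_def by blast
    show ?thesis
    proof (cases "B = P")
      case True
      obtain x where x: "x \<in> X" using partition_on_part_ex[OF pR X] by blast
      have "part_descents W S X = part_descents W S P"
        using part_descents_eq[OF lcR X x] part_descents_eq[OF Q P(1), of x] x B True by auto
      then obtain X' where "X' \<in> R" "s <# X \<subseteq> X'"
        using R X P unfolding regular_partition_def by blast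
      then obtain B' where B': "B' \<in> Q" "s <# X \<subseteq> B'"
        using \<open>part_le W Q R\<close> unfolding part_le_def refines_def by blast
      have "B' \<subseteq> carrier W" "X \<subseteq> carrier W"
        using partition_onD1[OF pQ] partition_onD1[OF pR] B' X by auto
      then have "X \<subseteq> P \<inter> (s <# B')"
        using B B' True P gen_l_coset_subset_iff[of s X B'] by simp
      \<comment> \<open>This point puts \<open>B'\<close> into the index set of the simple
        refinement.\<close>
      moreover have "s \<otimes> x \<in> B' \<inter> (s <# P)"
        using x B B' True unfolding l_coset_def by blast
      ultimately show ?thesis
        using B' unfolding simple_refinement_def Let_def by blast
    next
      case False
      then show ?thesis using B unfolding simple_refinement_def Let_def by blast
    qed
  qed
  moreover have "partition_on (carrier W) (simple_refinement W Q P s)"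
    using refines_simple_refinement[OF pQ ref] unfolding refines_def by blast
  ultimately show ?thesis
    using pR unfolding part_le_def refines_def by blast
qed

section \<open>The descent partition and the initial partition\<close>

lemma partition_on_descent_partition: "partition_on (carrier W) (descent_partition W S)"
proof -
  have "equiv (carrier W) {(v, w). v \<in> carrier W \<and> w \<in> carrier W \<and>
      left_descents W S w = left_descents W S v}" (is "equiv _ ?r")
    by (intro equivI refl_onI symI transI) auto
  then have "partition_on (carrier W) (carrier W // ?r)" by (rule partition_on_quotient)
  moreover have "descent_partition W S = carrier W // ?r"
    unfolding descent_partition_def quotient_def by auto
  ultimately show ?thesis by simp
qed

lemma finite_descent_partition: "finite S \<Longrightarrow> finite (descent_partition W S)"
proof -
  assume "finite S"
  have "descent_partition W S \<subseteq> (\<lambda>D. {w \<in> carrier W. left_descents W S w = D}) ` Pow S"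
    unfolding descent_partition_def left_descents_def by auto
  then show ?thesis using \<open>finite S\<close> by (meson finite_Pow_iff finite_imageI finite_subset)
qed

text \<open>Turning local constancy into an order condition lets the universal property of the
  common refinement handle the initial partition.\<close>

lemma refines_descent_partition_iff:
  "refines (carrier W) R (descent_partition W S) \<longleftrightarrow> locally_constant W S R"
proof
  assume R: "refines (carrier W) R (descent_partition W S)"
  moreover have "locally_constant W S (descent_partition W S)"
    using partition_on_descent_partition unfolding locally_constant_def descent_partition_def
    by auto
  ultimately show "locally_constant W S R" by (metis refines_locally_constant)
next
  assume R: "locally_constant W S R"
  have "\<exists>Y\<in>descent_partition W S. X \<subseteq> Y" if "X \<in> R" for X
  proof -
    have "partition_on (carrier W) R" using R unfolding locally_constant_def by blast
    then obtain x where x: "x \<in> X" and "X \<subseteq> carrier W"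
      using partition_on_part_ex[OF _ \<open>X \<in> R\<close>] by blast
    then have "X \<subseteq> {w \<in> carrier W. left_descents W S w = left_descents W S x}"
      using R that unfolding locally_constant_def by blast
    then show ?thesis
      using x \<open>X \<subseteq> carrier W\<close> unfolding descent_partition_def by blast
  qed
  then show "refines (carrier W) R (descent_partition W S)"
    using R partition_on_descent_partition unfolding refines_def locally_constant_def by blast
qed

lemma initial_partition_props:
  assumes "partition_on (carrier W) \<P>"
  shows "locally_constant W S (initial_partition W S \<P>)"
    and "part_le W \<P> (initial_partition W S \<P>)"
    and "regular_partition W S R \<Longrightarrow> part_le W \<P> R \<Longrightarrow> part_le W (initial_partition W S \<P>) R"
proof -
  have parts: "\<And>P. P \<in> {\<P>, descent_partition W S} \<Longrightarrow> partition_on (carrier W) P"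
    using assms partition_on_descent_partition by blast
  show "locally_constant W S (initial_partition W S \<P>)"
    unfolding refines_descent_partition_iff[symmetric] initial_partition_def
    using refines_common_refinement[OF parts] by blast
  show "part_le W \<P> (initial_partition W S \<P>)"
    unfolding part_le_def initial_partition_def
    using refines_common_refinement[OF parts] by blast
  assume R: "regular_partition W S R" "part_le W \<P> R"
  then have "refines (carrier W) R (descent_partition W S)"
    unfolding refines_descent_partition_iff regular_partition_def by blast
  then have fine: "refines (carrier W) R P" if "P \<in> {\<P>, descent_partition W S}" for P
    using that R(2) unfolding part_le_def by blast
  have R_part: "partition_on (carrier W) R" using R(2) unfolding part_le_def refines_def by blast
  show "part_le W (initial_partition W S \<P>) R"
    unfolding part_le_def initial_partition_def
    by (rule common_refinement_coarsest[OF _ R_part]) (use parts fine in blast)+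
qed

lemma finite_initial_partition:
  assumes "finite S" "finite \<P>"
  shows "finite (initial_partition W S \<P>)"
  unfolding initial_partition_def
  using assms finite_descent_partition by (intro finite_common_refinement) auto

lemma finite_simple_refinement:
  "finite Q \<Longrightarrow> finite (simple_refinement W Q P s)"
  unfolding simple_refinement_def Let_def by simp

section \<open>Runs of the algorithm: invariants, output and termination\<close>

lemma algorithm_run_step:
  assumes "algorithm_run W S \<P> run" "run j = Some Q"
  shows "if \<exists>P s. refinable_at W S Q P s
    then \<exists>P s. refinable_at W S Q P s \<and> run (Suc j) = Some (simple_refinement W Q P s)
    else run (Suc j) = None"
  using conjunct2[OF assms(1)[unfolded algorithm_run_def], THEN spec[of _ j]]
  unfolding assms(2) option.case .

lemma algorithm_run_Suc:
  assumes run: "algorithm_run W S \<P> run" and Suc: "run (Suc j) = Some Q'"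
  obtains Q P s where "run j = Some Q" "refinable_at W S Q P s" "Q' = simple_refinement W Q P s"
proof (cases "run j")
  case None
  then have "run (Suc j) = None"
    using conjunct2[OF run[unfolded algorithm_run_def], THEN spec[of _ j]] by simp
  then show ?thesis using Suc by simp
next
  case (Some Q)
  then show ?thesis using algorithm_run_step[OF run Some] Suc that by (auto split: if_splits)
qed

text \<open>Every partition of a run is squeezed between \<open>\<P>\<close> and all regular
  partitions finer than \<open>\<P>\<close>. Local constancy is carried along because the bound for
  a simple refinement relies on it.\<close>

lemma algorithm_run_invariant:
  assumes P: "partition_on (carrier W) \<P>" and run: "algorithm_run W S \<P> run"
    and "run j = Some Q"
  shows "locally_constant W S Q \<and> part_le W \<P> Q \<and>
    (\<forall>R. regular_partition W S R \<longrightarrow> part_le W \<P> R \<longrightarrow> part_le W Q R)"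
  using \<open>run j = Some Q\<close>
proof (induction j arbitrary: Q)
  case 0
  then have "Q = initial_partition W S \<P>" using run unfolding algorithm_run_def by simp
  then show ?case using initial_partition_props[OF P] by blast
next
  case (Suc j)
  then obtain Q0 X s where Q0: "run j = Some Q0" and ref: "refinable_at W S Q0 X s"
    and Q: "Q = simple_refinement W Q0 X s"
    using algorithm_run_Suc[OF run] by blast
  note IH = Suc.IH[OF Q0]
  have "partition_on (carrier W) Q0" using IH unfolding locally_constant_def by blast
  then have QQ0: "refines (carrier W) Q Q0" using refines_simple_refinement ref Q by blast
  have "locally_constant W S Q" using IH refines_locally_constant QQ0 by blast
  moreover have "part_le W \<P> Q"
    using IH QQ0 refines_trans unfolding part_le_def by blast
  moreover have "part_le W Q R" if "regular_partition W S R" "part_le W \<P> R" for R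
    unfolding Q using IH ref that by (intro simple_refinement_le_regular) auto
  ultimately show ?case by blast
qed

text \<open>Each step is a proper refinement of a finite partition and so adds at least one part;
  the step index therefore bounds the number of parts from below.\<close>

lemma algorithm_run_finite_card:
  assumes P: "partition_on (carrier W) \<P>" and run: "algorithm_run W S \<P> run"
    and "finite S" "finite \<P>" and "run j = Some Q"
  shows "finite Q \<and> j \<le> card Q"
  using \<open>run j = Some Q\<close>
proof (induction j arbitrary: Q)
  case 0
  then have "Q = initial_partition W S \<P>" using run unfolding algorithm_run_def by simp
  then show ?case using finite_initial_partition assms by blast
next
  case (Suc j)
  then obtain Q0 X s where Q0: "run j = Some Q0" and ref: "refinable_at W S Q0 X s"
    and Q: "Q = simple_refinement W Q0 X s"
    using algorithm_run_Suc[OF run] by blast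
  have pQ0: "partition_on (carrier W) Q0"
    using algorithm_run_invariant[OF P run Q0] unfolding locally_constant_def by blast
  have "finite Q" using Suc.IH[OF Q0] Q finite_simple_refinement by blast
  moreover have "card Q0 < card Q"
    using refines_card_less[OF refines_simple_refinement[OF pQ0 ref]]
      simple_refinement_neq[OF pQ0 ref] \<open>finite Q\<close> Q by blast
  ultimately show ?case using Suc.IH[OF Q0] by linarith
qed

text \<open>Stopping means that no pair is refinable, which for a locally constant partition is
  regularity; the invariant then makes the output the coarsest regular partition finer than
  \<open>\<P>\<close>.\<close>

lemma outputs_eq_regular_completion:
  assumes P: "partition_on (carrier W) \<P>" and run: "algorithm_run W S \<P> run"
    and "outputs run Q"
  shows "Q = regular_completion W S \<P>"
proof -
  obtain j where j: "run j = Some Q" "run (Suc j) = None"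
    using \<open>outputs run Q\<close> unfolding outputs_def by blast
  then have "\<not> refinable_at W S Q X s" for X s
    using algorithm_run_step[OF run j(1)] by (auto split: if_splits)
  then have "regular_partition W S Q"
    using algorithm_run_invariant[OF P run j(1)]
    unfolding regular_partition_def refinable_at_def by blast
  then show ?thesis
    using regular_completion_eq algorithm_run_invariant[OF P run j(1)] by metis
qed

lemma terminates_iff_finite_regular_completion:
  assumes P: "partition_on (carrier W) \<P>" and run: "algorithm_run W S \<P> run"
    and fin: "finite S" "finite \<P>"
  shows "terminates run \<longleftrightarrow> finite (regular_completion W S \<P>)"
proof
  assume "terminates run"
  then obtain Q where Q: "outputs run Q" unfolding terminates_def by blast
  then obtain j where "run j = Some Q" unfolding outputs_def by blast
  then have "finite Q" using algorithm_run_finite_card[OF P run fin] by blast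
  then show "finite (regular_completion W S \<P>)"
    using outputs_eq_regular_completion[OF P run Q] by simp
next
  let ?H = "regular_completion W S \<P>"
  assume "finite ?H"
  show "terminates run"
  proof (rule ccontr)
    assume nt: "\<not> terminates run"
    \<comment> \<open>A first \<open>None\<close> would make the preceding partition an output, so a
      run without output is defined at every index.\<close>
    have "\<exists>Q. run j = Some Q" for j
    proof (induction j)
      case 0
      then show ?case using run unfolding algorithm_run_def by blast
    next
      case (Suc j)
      then obtain Q where "run j = Some Q" by blast
      moreover have "\<not> outputs run Q" using nt unfolding terminates_def by blast
      ultimately have "run (Suc j) \<noteq> None" unfolding outputs_def by metis
      then show ?case by simp
    qed
    \<comment> \<open>One index beyond \<open>card ?H\<close> suffices: this \<open>Q\<close> has
      more parts than \<open>?H\<close>, yet the invariant makes it coarser than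
      \<open>?H\<close>.\<close>
    then obtain Q where Q: "run (Suc (card ?H)) = Some Q" by blast
    have "part_le W Q ?H"
      using algorithm_run_invariant[OF P run Q] part_le_regular_completion[OF P]
        regular_regular_completion[OF P] by blast
    then have "card Q \<le> card ?H"
      using refines_card_le(2) \<open>finite ?H\<close> unfolding part_le_def by blast
    then show False using algorithm_run_finite_card[OF P run fin Q] by linarith
  qed
qed

end

theorem theorem3p24:
  fixes W :: "('a, 'b) monoid_scheme" and S :: "'a set" and \<P> :: "'a set set"
  assumes "coxeter_system W S"
    and "finite S"
    and "partition_on (carrier W) \<P>"
  shows "part_le W \<P> (regular_completion W S \<P>) \<and>
    (\<forall>run \<Q>. algorithm_run W S \<P> run \<longrightarrow> outputs run \<Q> \<longrightarrow>
       \<Q> = regular_completion W S \<P>) \<and>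
    (finite \<P> \<longrightarrow>
       (\<forall>run. algorithm_run W S \<P> run \<longrightarrow>
          (terminates run \<longleftrightarrow> finite (regular_completion W S \<P>))))"
proof -
  interpret involutions W S using assms(1) by (rule coxeter_system_involutions)
  show ?thesis
    using part_le_regular_completion outputs_eq_regular_completion
      terminates_iff_finite_regular_completion assms(2,3) by blast
qed

end
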